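(* For all integers $k\ge 2$, $n_1,\dots,n_k\ge 2$ and $q\ge 1$, \[ c_{q+1}(n_1,\dots,n_k)=\frac12 f_q(n_1,\dots,n_k), \] where $c_{q+1}(n_1,\dots,n_k)$ is the number of $(q+1)$-gridsegments of the grid $G(n_1,\dots,n_k)$ and \[ f_q(n_1,\dots,n_k)=\sum_{\substack{-n_1<i_1<n_1,\ \dots,\ -n_k<i_k<n_k\\ \gcd(i_1,\dots,i_k)=q}}(n_1-|i_1|)\cdots(n_k-|i_k|), \] the sum being over integer tuples $(i_1,\dots,i_k)$.
   Context: For integers $k,n_1,\dots,n_k\ge 2$, let $G(n_1,\dots,n_k)=\{0,\dots,n_1-1\}\times\dots\times\{0,\dots,n_k-1\}\subset\mathbb{R}^k$; its points are called gridpoints. For an integer $q\ge 2$, a line segment in $\mathbb{R}^k$ is called a $q$-gridsegment if its two (distinct) endpoints are gridpoints and exactly $q-2$ of its interior points are gridpoints. $c_q(n_1,\dots,n_k)$ denotes the number of all $q$-gridsegments; segments are counted as sets (unoriented), and different segments may partially overlap. The gcd of integers is taken to be nonnegative, with $\gcd(0,\dots,0)=0$. *)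

theory Defs
  imports "HOL-Analysis.Analysis"
begin

text \<open>
  The dimension is the cardinality of the finite index type \<open>'k\<close>; the side lengths
  $n_1, \ldots, n_k$ are the components of a vector \<open>n :: int ^ 'k\<close>.
\<close>

definition grid :: "int ^ 'k \<Rightarrow> (real ^ 'k::finite) set" where
  "grid n = {x. \<forall>j. \<exists>m::int. 0 \<le> m \<and> m < n $ j \<and> x $ j = of_int m}"

text \<open>
  A segment is identified with its point set, so \<open>closed_segment a b\<close> and
  \<open>closed_segment b a\<close> are the same segment. The condition on interior gridpoints is written
  with \<open>+ 2\<close> to avoid truncated subtraction of natural numbers.
\<close>

definition gridsegments :: "nat \<Rightarrow> int ^ 'k \<Rightarrow> (real ^ 'k::finite) set set" where
  "gridsegments q n =
    {closed_segment a b | a b. a \<in> grid n \<and> b \<in> grid n \<and> a \<noteq> b \<and>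
       card (open_segment a b \<inter> grid n) + 2 = q}"

definition gridsegment_count :: "nat \<Rightarrow> int ^ 'k::finite \<Rightarrow> nat" where
  "gridsegment_count q n = card (gridsegments q n)"

definition gcd_sum :: "nat \<Rightarrow> int ^ 'k::finite \<Rightarrow> int" where
  "gcd_sum q n =
    (\<Sum>i | (\<forall>j. - (n $ j) < i $ j \<and> i $ j < n $ j) \<and> Gcd (range (\<lambda>j. i $ j)) = int q.
      \<Prod>j\<in>UNIV. (n $ j - \<bar>i $ j\<bar>))"

end

theory Submission
  imports Defs
begin

text \<open>
  An ordered pair of gridpoints with difference vector \<open>i\<close> has exactly \<open>gcd i - 1\<close> gridpoints
  strictly between its members, namely the translates of the first by the multiples of
  \<open>i / gcd i\<close>, and there are \<open>\<Prod>j (n j - \<bar>i j\<bar>)\<close> such pairs in the grid. Every segment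
  comes from exactly two ordered pairs.
\<close>

definition int_box :: "int ^ 'k \<Rightarrow> (int ^ 'k::finite) set" where
  "int_box n = {u. \<forall>j. 0 \<le> u $ j \<and> u $ j < n $ j}"

text \<open>Gridpoints are real vectors, while gcds and divisibility need integer coordinates. This
  embedding lets everything except the betweenness test be done over the integers.\<close>

definition real_vec :: "int ^ 'k \<Rightarrow> real ^ 'k::finite" where
  "real_vec u = (\<chi> j. of_int (u $ j))"

definition vec_gcd :: "int ^ 'k::finite \<Rightarrow> int" where
  "vec_gcd i = Gcd (range (($) i))"

lemma real_vec_nth [simp]: "real_vec u $ j = of_int (u $ j)"
  by (simp add: real_vec_def)

lemma real_vec_eq_iff [simp]: "real_vec u = real_vec v \<longleftrightarrow> u = v"
  by (simp add: vec_eq_iff)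

lemma inj_real_vec: "inj real_vec"
  by (simp add: inj_def)

lemma grid_eq_image: "grid n = real_vec ` int_box n"
proof (intro equalityI subsetI)
  fix x assume "x \<in> grid n"
  then obtain m where m: "\<And>j. 0 \<le> m j \<and> m j < n $ j \<and> x $ j = of_int (m j)"
    unfolding grid_def mem_Collect_eq by metis
  then have "x = real_vec (\<chi> j. m j)" "(\<chi> j. m j) \<in> int_box n"
    by (simp_all add: vec_eq_iff int_box_def)
  then show "x \<in> real_vec ` int_box n" by blast
qed (auto simp: grid_def int_box_def)

lemma vec_gcd_nonneg: "0 \<le> vec_gcd i"
  by (metis vec_gcd_def Gcd_int_greater_eq_0)

lemma vec_gcd_dvd: "vec_gcd i dvd i $ j"
  by (simp add: vec_gcd_def)

lemma dvd_vec_gcdI: "(\<And>j. b dvd i $ j) \<Longrightarrow> b dvd vec_gcd i"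
  by (auto simp: vec_gcd_def intro: Gcd_greatest)

lemma vec_gcd_eq_0_iff: "vec_gcd i = 0 \<longleftrightarrow> i = 0"
  by (auto simp: vec_gcd_def vec_eq_iff)

lemma card_vec_set:
  fixes S :: "'k::finite \<Rightarrow> 'a set"
  shows "card {u :: 'a ^ 'k. \<forall>j. u $ j \<in> S j} = (\<Prod>j\<in>UNIV. card (S j))"
proof -
  have "bij_betw vec_nth {u :: 'a ^ 'k. \<forall>j. u $ j \<in> S j} (PiE UNIV S)"
    by (rule bij_betw_byWitness[where f' = vec_lambda]) (auto simp: PiE_iff)
  then show ?thesis
    by (simp add: bij_betw_same_card card_PiE)
qed

lemma finite_vec_set:
  fixes S :: "'k::finite \<Rightarrow> 'a set"
  assumes "\<And>j. finite (S j)"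
  shows "finite {u :: 'a ^ 'k. \<forall>j. u $ j \<in> S j}"
proof -
  have "bij_betw vec_nth {u :: 'a ^ 'k. \<forall>j. u $ j \<in> S j} (PiE UNIV S)"
    by (rule bij_betw_byWitness[where f' = vec_lambda]) (auto simp: PiE_iff)
  then show ?thesis
    using assms by (simp add: bij_betw_finite finite_PiE)
qed

lemma finite_int_box: "finite (int_box n)"
  using finite_vec_set[of "\<lambda>j. {0..<n $ j}"] by (simp add: int_box_def)

text \<open>The condition splits by coordinate: each \<open>u $ j\<close> ranges over an integer
  interval of length \<open>n $ j - \<bar>i $ j\<bar>\<close>. The bound on \<open>i\<close> keeps
  this length positive, so no cardinality is truncated at 0.\<close>

lemma card_int_box_translates:
  fixes n i :: "int ^ 'k::finite"
  assumes "\<And>j. \<bar>i $ j\<bar> < n $ j"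
  shows "int (card {u \<in> int_box n. u + i \<in> int_box n}) = (\<Prod>j\<in>UNIV. n $ j - \<bar>i $ j\<bar>)"
proof -
  have "{u \<in> int_box n. u + i \<in> int_box n} =
      {u. \<forall>j. u $ j \<in> {max 0 (- (i $ j))..<min (n $ j) (n $ j - i $ j)}}"
    by (auto simp: int_box_def less_diff_eq add.commute)
      (smt (verit))+
  moreover have "int (card {max 0 (- (i $ j))..<min (n $ j) (n $ j - i $ j)}) = n $ j - \<bar>i $ j\<bar>" for j
    using assms[of j] by auto
  ultimately show ?thesis
    by (simp only: card_vec_set of_nat_prod)
qed

text \<open>A gridpoint at parameter \<open>t\<close> forces \<open>t\<close> to be rational with a
  denominator dividing the gcd \<open>g\<close>. Hence \<open>t = s / g\<close>, and
  \<open>s\<close> counts primitive steps from \<open>u\<close>.\<close>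

lemma in_open_segment_real_vec_iff:
  assumes "u \<noteq> v"
  shows "real_vec w \<in> open_segment (real_vec u) (real_vec v) \<longleftrightarrow>
    (\<exists>s. 0 < s \<and> s < vec_gcd (v - u) \<and>
      (\<forall>j. w $ j = u $ j + s * ((v $ j - u $ j) div vec_gcd (v - u))))"
    (is "?L \<longleftrightarrow> ?R")
proof -
  define g where "g = vec_gcd (v - u)"
  have g: "g > 0"
    using assms vec_gcd_nonneg[of "v - u"] vec_gcd_eq_0_iff[of "v - u"] by (simp add: g_def)
  define e where "e j = (v $ j - u $ j) div g" for j
  have ge: "v $ j - u $ j = g * e j" for j
    using vec_gcd_dvd[of "v - u" j] by (simp add: e_def g_def)
  have L: "?L \<longleftrightarrow> (\<exists>t. 0 < t \<and> t < 1 \<and> (\<forall>j. real_of_int (w $ j - u $ j) = t * real_of_int (g * e j)))"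
    using assms unfolding in_segment ge[symmetric] by (simp add: vec_eq_iff algebra_simps)
  have R: "?R \<longleftrightarrow> (\<exists>s. 0 < s \<and> s < g \<and> (\<forall>j. w $ j - u $ j = s * e j))"
    by (simp add: g_def e_def algebra_simps)
  show ?thesis unfolding L R
  proof safe
    fix s assume s: "0 < s" "s < g" "\<forall>j. w $ j - u $ j = s * e j"
    then show "\<exists>t>0. t < 1 \<and> (\<forall>j. real_of_int (w $ j - u $ j) = t * real_of_int (g * e j))"
      using g by (intro exI[of _ "real_of_int s / real_of_int g"]) simp
  next
    fix t :: real
    assume t: "0 < t" "t < 1" "\<forall>j. real_of_int (w $ j - u $ j) = t * real_of_int (g * e j)"
    \<comment> \<open>In a coordinate where the endpoints differ, \<open>t\<close> is a quotient of
      two integers, hence rational.\<close>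
    obtain j where j: "g * e j \<noteq> 0"
      using assms ge by (metis eq_iff_diff_eq_0 vec_eq_iff)
    have "t = real_of_int (w $ j - u $ j) / real_of_int (g * e j)"
      using t(3) j by (metis nonzero_mult_div_cancel_right of_int_eq_0_iff)
    then have "t \<in> \<rat>" by simp
    then obtain a b where ab: "b > 0" "coprime a b" "t = of_int a / of_int b"
      by (rule Rats_cases')
    have "real_of_int b * real_of_int (w $ j - u $ j) = real_of_int a * real_of_int (g * e j)" for j
      using t(3) ab by (simp add: field_simps)
    then have abj: "b * (w $ j - u $ j) = a * (g * e j)" for j
      by (metis of_int_eq_iff of_int_mult)
    \<comment> \<open>As \<open>b\<close> is coprime to \<open>a\<close>, it divides every
      coordinate of \<open>v - u\<close>, and therefore their gcd.\<close>
    have "b dvd g * e j" for j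
      using abj[of j] ab(2) by (metis coprime_commute coprime_dvd_mult_right_iff dvd_triv_left)
    then have "b dvd g"
      unfolding g_def by (intro dvd_vec_gcdI) (use ge g_def in simp)
    then obtain c where c: "g = b * c" ..
    have "c > 0" using g ab(1) c by (simp add: zero_less_mult_iff)
    moreover have "0 < a" "a < b" using t(1,2) ab(1,3) by (simp_all add: zero_less_divide_iff)
    moreover have "w $ j - u $ j = a * c * e j" for j
      using abj[of j] ab(1) c by (simp add: mult.left_commute mult.assoc)
    \<comment> \<open>With \<open>g = b * c\<close>, the parameter is
      \<open>a / b = (a * c) / g\<close>, which gives the witness \<open>a * c\<close>.\<close>
    ultimately show "\<exists>s>0. s < g \<and> (\<forall>j. w $ j - u $ j = s * e j)"
      using c by (intro exI[of _ "a * c"]) auto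
  qed
qed

lemma card_open_segment_grid:
  assumes u: "u \<in> int_box n" and v: "v \<in> int_box n" and "u \<noteq> v"
  shows "int (card (open_segment (real_vec u) (real_vec v) \<inter> grid n)) + 1 = vec_gcd (v - u)"
proof -
  define g where "g = vec_gcd (v - u)"
  have g: "g > 0"
    using assms vec_gcd_nonneg[of "v - u"] vec_gcd_eq_0_iff[of "v - u"] by (simp add: g_def)
  define p where "p s = (\<chi> j. u $ j + s * ((v $ j - u $ j) div g))" for s
  have ge: "v $ j - u $ j = g * ((v $ j - u $ j) div g)" for j
    using vec_gcd_dvd[of "v - u" j] by (simp add: g_def)
  have "p s \<in> int_box n" if "0 < s" "s < g" for s
  proof -
    \<comment> \<open>The box is convex: \<open>s * e\<close> lies between 0 and
      \<open>g * e\<close>, so the coordinate lies between those of \<open>u\<close> and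
      \<open>v\<close>. The sign of \<open>e\<close> decides which end is the lower one.\<close>
    have "0 \<le> u $ j + s * e \<and> u $ j + s * e < n $ j" if "v $ j - u $ j = g * e" for j e
    proof (cases "e \<ge> 0")
      case True
      then have "0 \<le> s * e" "s * e \<le> g * e"
        using \<open>0 < s\<close> \<open>s < g\<close> by (simp_all add: mult_right_mono)
      then show ?thesis using u v that unfolding int_box_def by (smt (verit) mem_Collect_eq)
    next
      case False
      then have "s * e \<le> 0" "g * e \<le> s * e"
        using \<open>0 < s\<close> \<open>s < g\<close> by (simp_all add: mult_right_mono_neg mult_nonneg_nonpos)
      then show ?thesis using u v that unfolding int_box_def by (smt (verit) mem_Collect_eq)
    qed
    from this[OF ge] show ?thesis by (simp add: p_def int_box_def)
  qed
  then have "open_segment (real_vec u) (real_vec v) \<inter> grid n = (\<lambda>s. real_vec (p s)) ` {0<..<g}"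
    unfolding grid_eq_image
    by (fastforce simp: in_open_segment_real_vec_iff[OF \<open>u \<noteq> v\<close>] p_def vec_eq_iff
        simp flip: g_def)
  moreover have "inj_on (\<lambda>s. real_vec (p s)) {0<..<g}"
  proof -
    \<comment> \<open>A nonzero coordinate of the primitive step separates the points for different
      \<open>s\<close>.\<close>
    obtain j where "(v $ j - u $ j) div g \<noteq> 0"
      using \<open>u \<noteq> v\<close> ge by (metis eq_iff_diff_eq_0 mult_zero_right vec_eq_iff)
    then show ?thesis by (auto simp: inj_on_def p_def vec_eq_iff dest: spec[of _ j])
  qed
  ultimately show ?thesis
    using g by (simp add: card_image g_def)
qed

text \<open>Turns the comprehension in \<open>gridsegments\<close> into the image of a set of
  integer pairs, whose fibres can then be counted. Injectivity of \<open>h\<close> carries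
  distinctness of the points over to their images.\<close>

lemma setcompr2_image_eq:
  assumes "inj h"
  shows "{f a b | a b. a \<in> h ` B \<and> b \<in> h ` B \<and> a \<noteq> b \<and> R a b} =
    (\<lambda>(u, v). f (h u) (h v)) ` {(u, v). u \<in> B \<and> v \<in> B \<and> u \<noteq> v \<and> R (h u) (h v)}"
    (is "?L = ?R")
proof
  show "?L \<subseteq> ?R" by fastforce
  show "?R \<subseteq> ?L" using assms by (force simp: inj_eq)
qed

theorem theorem1:
  fixes n :: "int ^ 'k::finite" and q :: nat
  assumes "CARD('k) \<ge> 2"
    and "\<And>j. n $ j \<ge> 2"
    and "q \<ge> 1"
  shows "real (gridsegment_count (q + 1) n) = 1 / 2 * real_of_int (gcd_sum q n)"
proof -
  define P where "P = {(u, v). u \<in> int_box n \<and> v \<in> int_box n \<and> vec_gcd (v - u) = int q}"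
  define seg where "seg = (\<lambda>(u, v). closed_segment (real_vec u) (real_vec v) :: (real ^ 'k) set)"
  define I where "I = {i. (\<forall>j. - (n $ j) < i $ j \<and> i $ j < n $ j) \<and> vec_gcd i = int q}"
  have "finite P"
    by (rule finite_subset[of _ "int_box n \<times> int_box n"]) (auto simp: P_def finite_int_box)
  \<comment> \<open>The zero vector has gcd 0, so \<open>q \<ge> 1\<close> excludes degenerate
    pairs.\<close>
  have P_neq: "u \<noteq> v" if "(u, v) \<in> P" for u v
    using that \<open>q \<ge> 1\<close> vec_gcd_eq_0_iff[of "v - u"] by (auto simp: P_def)
  have P_swap: "(v, u) \<in> P" if "(u, v) \<in> P" for u v
  proof -
    have "vec_gcd (u - v) = vec_gcd (v - u)"
      \<comment> \<open>Divisibility ignores signs, so each gcd divides the other; being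
        nonnegative, they are equal.\<close>
      by (intro zdvd_antisym_nonneg vec_gcd_nonneg dvd_vec_gcdI)
        (metis vec_gcd_dvd dvd_diff_commute vector_minus_component)+
    with that show ?thesis by (simp add: P_def)
  qed
  have "gridsegments (q + 1) n = seg ` P"
  proof -
    \<comment> \<open>The gcd minus 1 interior gridpoints and the 2 endpoints make gcd + 1
      gridpoints, which is why \<open>q + 1\<close> corresponds to gcd \<open>q\<close>.\<close>
    have "card (open_segment (real_vec u) (real_vec v) \<inter> grid n) + 2 = q + 1 \<longleftrightarrow>
        vec_gcd (v - u) = int q" if "u \<in> int_box n" "v \<in> int_box n" "u \<noteq> v" for u v
      using card_open_segment_grid[OF that] by linarith
    then have "P = {(u, v). u \<in> int_box n \<and> v \<in> int_box n \<and> u \<noteq> v \<and>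
        card (open_segment (real_vec u) (real_vec v) \<inter> grid n) + 2 = q + 1}"
      using P_neq unfolding P_def by blast
    then show ?thesis
      unfolding gridsegments_def seg_def grid_eq_image
      by (simp only: setcompr2_image_eq[OF inj_real_vec])
  qed
  moreover have "card P = 2 * card (seg ` P)"
  proof -
    have "card {p \<in> P. seg p = S} = 2" if "S \<in> seg ` P" for S
    proof -
      from that obtain u v where uv: "(u, v) \<in> P" "S = seg (u, v)" by auto
      \<comment> \<open>A closed segment determines its unordered pair of endpoints, so each fibre
        of \<open>seg\<close> on \<open>P\<close> consists of one pair and its swap.\<close>
      have "seg p = seg (u, v) \<longleftrightarrow> p = (u, v) \<or> p = (v, u)" for p
        by (cases p) (simp add: seg_def doubleton_eq_iff)
      then have "{p \<in> P. seg p = S} = {(u, v), (v, u)}"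
        using uv P_swap by blast
      then show ?thesis using P_neq[OF uv(1)] by simp
    qed
    then show ?thesis
      using sum.image_gen[OF \<open>finite P\<close>, of "\<lambda>_. 1 :: nat" seg] by simp
  qed
  moreover have "int (card P) = gcd_sum q n"
  proof -
    have "finite I"
      by (rule finite_subset[OF _ finite_vec_set[of "\<lambda>j. {- (n $ j)<..<n $ j}"]]) (auto simp: I_def)
    \<comment> \<open>Pairs are grouped by their difference \<open>i\<close>; the inner set holds
      the possible starting points.\<close>
    have "bij_betw (\<lambda>(i, u). (u, u + i)) (SIGMA i:I. {u \<in> int_box n. u + i \<in> int_box n}) P"
    proof (rule bij_betw_byWitness[where f' = "\<lambda>(u, v). (v - u, u)"])
      \<comment> \<open>Coordinates in \<open>[0, n $ j)\<close> differ by less than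
        \<open>n $ j\<close>, so the index range of \<open>gcd_sum\<close> misses no pair.\<close>
      have "v - u \<in> I" if "(u, v) \<in> P" for u v
        using that by (auto simp: P_def I_def int_box_def) (smt (verit))+
      then show "(\<lambda>(u, v). (v - u, u)) ` P \<subseteq> (SIGMA i:I. {u \<in> int_box n. u + i \<in> int_box n})"
        by (auto simp: P_def)
    qed (auto simp: P_def I_def)
    then have "card P = (\<Sum>i\<in>I. card {u \<in> int_box n. u + i \<in> int_box n})"
      using \<open>finite I\<close> finite_int_box[of n] by (simp add: bij_betw_same_card[symmetric])
    then have "int (card P) = (\<Sum>i\<in>I. \<Prod>j\<in>UNIV. n $ j - \<bar>i $ j\<bar>)"
      by (simp add: card_int_box_translates I_def abs_less_iff minus_less_iff)
    then show ?thesis by (simp add: gcd_sum_def I_def vec_gcd_def)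
  qed
  ultimately have "gcd_sum q n = 2 * int (gridsegment_count (q + 1) n)"
    by (simp add: gridsegment_count_def)
  then show ?thesis by simp
qed

end
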